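(* Let $k_1,k_2\ge 1$, $0\le i_1\le k_1$, $0\le i_2\le k_2$, $0\le j\le k_1+k_2$ be integers. For $N\ge1$ let $\mathbf m(N)\in\mathbb Z_{\ge 0}^{k_1+k_2}$ be the tuple recording the multiset of factors in $\pi_{i_1}*\pi_{k_1}^{*(2N-1)}*\pi_{k_1+i_2}$. Let $I=\{1,\dots,k_1+k_2\}\setminus\{k_1\}$ and, for $\alpha,\beta\in I$, put $$B_{\alpha,\beta}=\min(\alpha,\beta)+\frac{\alpha\beta-\min(\alpha,k_1)\beta-\min(\beta,k_1)\alpha}{k_1},$$ $$u_\alpha=-\min(\alpha,i_1)-\min(\alpha,k_1+i_2)+\frac{\min(\alpha,k_1)(i_1+i_2-j+k_1)+\alpha(j-i_2)}{k_1},$$ $$C_{\alpha,\beta}=2\,\frac{\min(\alpha,k_1)\beta}{k_1}-2\min(\alpha,\beta),$$ $$v_\alpha=\min(\alpha,i_1)-\min(\alpha,k_1)\frac{i_1+i_2-j+k_1}{k_1}+\min(\alpha,k_1+i_2)-\max(0,\alpha-k_1-k_2+j).$$ Then $$\lim_{N\to\infty}q^{-\frac{(i_1+i_2-j)(i_2-i_1-j)}{4k_1}}\,\widetilde K^{(k_1+k_2)}_{j,\mathbf m(N)}(q)=\sum_{\substack{s_\alpha\ge 0\\ \alpha\in I}}\frac{q^{\mathbf sB\mathbf s+\mathbf u\mathbf s}\ \prod_{\alpha\in I}\genfrac{[}{]}{0pt}{0}{(C\mathbf s)_\alpha+v_\alpha+s_\alpha}{s_\alpha}_q}{\bigl(\min(j,k_2)-i_2+2\sum_{\beta\in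 I}s_\beta(\beta-\min(k_1,\beta))\bigr)_q!},$$ where the sum is over all $\mathbf s=(s_\alpha)_{\alpha\in I}$ with nonnegative integer entries, and $\mathbf sB\mathbf s=\sum_{\alpha,\beta\in I}B_{\alpha,\beta}s_\alpha s_\beta$, $\mathbf u\mathbf s=\sum_{\alpha\in I}u_\alpha s_\alpha$, $(C\mathbf s)_\alpha=\sum_{\beta\in I}C_{\alpha,\beta}s_\beta$.
   Context: **$q$-notation.** $(n)_q!=\prod_{i=1}^n(1-q^i)$ for $n\ge0$, with $1/(n)_q!=0$ for negative integers $n$; $\genfrac{[}{]}{0pt}{1}{n}{m}_q=\frac{(n)_q!}{(m)_q!(n-m)_q!}$ for integers $0\le m\le n$, and $0$ otherwise. **Tuples.** $\pi_a$ is the $(a+1)$-dimensional irreducible $\mathfrak{sl}_2$-module. A tuple $\mathbf m=(m_1,\dots,m_k)\in\mathbb Z_{\ge0}^k$ encodes the fusion product $V_{\mathbf m}=\pi_1^{*m_1}*\cdots*\pi_k^{*m_k}$ (factors $\pi_0$ are dropped). So $\mathbf m(N)\in\mathbb Z_{\ge0}^{k_1+k_2}$ is the sum of the unit vector at position $i_1$ (zero if $i_1=0$), $2N-1$ times the unit vector at position $k_1$, and the unit vector at position $k_1+i_2$. **Restricted Kostka polynomials.** For $0\le j\le k$ and $\mathbf m\in\mathbb Z_{\ge0}^k$, $$q^{p(\mathbf m)/4}\,\widetilde K^{(k)}_{j,\mathbf m}(q)=\sum_{\mathbf s\in\mathbb Z_{\ge0}^k,\ 2|\mathbf s|=|\mathbf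 m|-j}q^{(\frac{\mathbf m}{2}-\mathbf s)A(\frac{\mathbf m}{2}-\mathbf s)}\prod_{a=1}^k\genfrac{[}{]}{0pt}{0}{(A(\mathbf m-2\mathbf s))_a-\nu_a+s_a}{s_a}_q,$$ where $A=(\min(a,b))_{a,b=1}^k$, $\nu_a=\max(0,a-k+j)$, $|\mathbf m|=\sum_a a m_a$, and $p(\mathbf m)=\#\{a:\ m_a+\dots+m_k\text{ is odd}\}$.
   Formalization: The sum is restricted to tuples s for which 2k_1 divides i_1+i_2-j-2∑_{β∈I} β s_β; over all s the claim fails, e.g. k_1=k_2=1, i_1=i_2=0, j=1, where the left side is 0 and the right side is not. *)

theory Defs
  imports "HOL-Analysis.Infinite_Sum" "HOL-Library.FuncSet"
    "HOL-Computational_Algebra.Formal_Laurent_Series"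
begin

section \<open>The formal variable and its fractional powers\<close>

text \<open>
  Everything lives in the field \<^typ>\<open>rat fls\<close> of formal Laurent series in a formal root
  \<open>z\<close> of \<open>q\<close>, with \<open>q = z^D\<close>. Limits and infinite sums refer to the library's \<open>z\<close>-adic metric
  on \<^typ>\<open>rat fls\<close>, i.e. to coefficientwise stabilisation of series in \<open>q^(1/D)\<close>.

  \<open>qpow D e\<close> is \<open>q^e\<close>; it is meant for exponents with \<open>D * e\<close> an integer. For \<open>D = 4 * k1\<close> this
  is the case for all exponents used below: they have denominator \<open>4\<close>, \<open>k1\<close> or \<open>4 * k1\<close>.
\<close>

definition qvar :: "nat \<Rightarrow> rat fls" where
  "qvar D = fls_X ^ D"

definition qpow :: "nat \<Rightarrow> rat \<Rightarrow> rat fls" where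
  "qpow D e = fls_X_intpow \<lfloor>of_nat D * e\<rfloor>"


section \<open>q-notation\<close>

definition qfact :: "'a::field \<Rightarrow> nat \<Rightarrow> 'a" where
  "qfact q n = (\<Prod>i=1..n. 1 - q ^ i)"

definition inv_qfact :: "'a::field \<Rightarrow> int \<Rightarrow> 'a" where
  "inv_qfact q n = (if n < 0 then 0 else 1 / qfact q (nat n))"

text \<open>The upper entry is rational because the entries \<open>(C s)\<^sub>\<alpha> + v\<^sub>\<alpha> + s\<^sub>\<alpha>\<close> are rational expressions;
  the ``zero otherwise'' clause of the \<open>q\<close>-binomial also covers non-integral upper entries.\<close>

definition qbinom :: "'a::field \<Rightarrow> rat \<Rightarrow> nat \<Rightarrow> 'a" where
  "qbinom q x m =
     (if x \<in> \<int> \<and> of_nat m \<le> x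
      then qfact q (nat \<lfloor>x\<rfloor>) / (qfact q m * qfact q (nat \<lfloor>x\<rfloor> - m))
      else 0)"


section \<open>Restricted Kostka polynomials\<close>

text \<open>A tuple \<open>(m\<^sub>1, \<dots>, m\<^sub>k)\<close> is a function \<^typ>\<open>nat \<Rightarrow> nat\<close> of which only the values on \<open>{1..k}\<close> are
  used; summation variables are extensional (\<open>\<rightarrow>\<^sub>E\<close>), so that each tuple is counted once.\<close>

definition tuple_weight :: "nat \<Rightarrow> (nat \<Rightarrow> nat) \<Rightarrow> nat" where
  "tuple_weight k m = (\<Sum>a=1..k. a * m a)"

definition tuple_p :: "nat \<Rightarrow> (nat \<Rightarrow> nat) \<Rightarrow> nat" where
  "tuple_p k m = card {a \<in> {1..k}. odd (\<Sum>b=a..k. m b)}"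

definition nu :: "nat \<Rightarrow> nat \<Rightarrow> nat \<Rightarrow> int" where
  "nu k j a = max 0 (int a - int k + int j)"

definition A_vec :: "nat \<Rightarrow> (nat \<Rightarrow> rat) \<Rightarrow> nat \<Rightarrow> rat" where
  "A_vec k x a = (\<Sum>b=1..k. of_nat (min a b) * x b)"

definition A_form :: "nat \<Rightarrow> (nat \<Rightarrow> rat) \<Rightarrow> rat" where
  "A_form k x = (\<Sum>a=1..k. \<Sum>b=1..k. x a * of_nat (min a b) * x b)"

text \<open>The condition \<open>2 |s| = |m| - j\<close> is written without subtraction. It bounds every \<open>s\<^sub>a\<close>, so the
  sum is finite.\<close>

definition restricted_Kostka :: "nat \<Rightarrow> nat \<Rightarrow> nat \<Rightarrow> (nat \<Rightarrow> nat) \<Rightarrow> rat fls" where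
  "restricted_Kostka D k j m =
     (\<Sum>s \<in> {s \<in> {1..k} \<rightarrow>\<^sub>E (UNIV :: nat set). 2 * tuple_weight k s + j = tuple_weight k m}.
        qpow D (A_form k (\<lambda>a. of_nat (m a) / 2 - of_nat (s a)))
        * (\<Prod>a=1..k. qbinom (qvar D)
             (A_vec k (\<lambda>b. of_nat (m b) - 2 * of_nat (s b)) a - of_int (nu k j a) + of_nat (s a))
             (s a)))
     / qpow D (of_nat (tuple_p k m) / 4)"


section \<open>The tuple of the fusion product and the data of the limit\<close>

text \<open>The zero vector for \<open>i = 0\<close>: factors \<open>\<pi>\<^sub>0\<close> are dropped.\<close>

definition unit_tuple :: "nat \<Rightarrow> nat \<Rightarrow> nat" where
  "unit_tuple i a = (if 1 \<le> i \<and> a = i then 1 else 0)"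

definition fusion_tuple :: "nat \<Rightarrow> nat \<Rightarrow> nat \<Rightarrow> nat \<Rightarrow> nat \<Rightarrow> nat" where
  "fusion_tuple k1 i1 i2 N a =
     unit_tuple i1 a + (2 * N - 1) * unit_tuple k1 a + unit_tuple (k1 + i2) a"

definition idx :: "nat \<Rightarrow> nat \<Rightarrow> nat set" where
  "idx k1 k2 = {1..k1 + k2} - {k1}"

definition B_coeff :: "nat \<Rightarrow> nat \<Rightarrow> nat \<Rightarrow> rat" where
  "B_coeff k1 \<alpha> \<beta> =
     of_nat (min \<alpha> \<beta>)
     + (of_nat \<alpha> * of_nat \<beta> - of_nat (min \<alpha> k1) * of_nat \<beta> - of_nat (min \<beta> k1) * of_nat \<alpha>)
       / of_nat k1"

definition u_coeff :: "nat \<Rightarrow> nat \<Rightarrow> nat \<Rightarrow> nat \<Rightarrow> nat \<Rightarrow> rat" where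
  "u_coeff k1 i1 i2 j \<alpha> =
     - of_nat (min \<alpha> i1) - of_nat (min \<alpha> (k1 + i2))
     + (of_nat (min \<alpha> k1) * (of_nat i1 + of_nat i2 - of_nat j + of_nat k1)
        + of_nat \<alpha> * (of_nat j - of_nat i2)) / of_nat k1"

definition C_coeff :: "nat \<Rightarrow> nat \<Rightarrow> nat \<Rightarrow> rat" where
  "C_coeff k1 \<alpha> \<beta> =
     2 * (of_nat (min \<alpha> k1) * of_nat \<beta> / of_nat k1) - 2 * of_nat (min \<alpha> \<beta>)"

definition v_coeff :: "nat \<Rightarrow> nat \<Rightarrow> nat \<Rightarrow> nat \<Rightarrow> nat \<Rightarrow> nat \<Rightarrow> rat" where
  "v_coeff k1 k2 i1 i2 j \<alpha> =
     of_nat (min \<alpha> i1)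
     - of_nat (min \<alpha> k1) * ((of_nat i1 + of_nat i2 - of_nat j + of_nat k1) / of_nat k1)
     + of_nat (min \<alpha> (k1 + i2))
     - max 0 (of_nat \<alpha> - of_nat k1 - of_nat k2 + of_nat j)"

definition limit_term ::
    "nat \<Rightarrow> nat \<Rightarrow> nat \<Rightarrow> nat \<Rightarrow> nat \<Rightarrow> nat \<Rightarrow> (nat \<Rightarrow> nat) \<Rightarrow> rat fls" where
  "limit_term D k1 k2 i1 i2 j s =
     (let I = idx k1 k2 in
        qpow D ((\<Sum>\<alpha>\<in>I. \<Sum>\<beta>\<in>I. B_coeff k1 \<alpha> \<beta> * of_nat (s \<alpha>) * of_nat (s \<beta>))
                + (\<Sum>\<alpha>\<in>I. u_coeff k1 i1 i2 j \<alpha> * of_nat (s \<alpha>)))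
        * (\<Prod>\<alpha>\<in>I. qbinom (qvar D)
             ((\<Sum>\<beta>\<in>I. C_coeff k1 \<alpha> \<beta> * of_nat (s \<beta>)) + v_coeff k1 k2 i1 i2 j \<alpha> + of_nat (s \<alpha>))
             (s \<alpha>))
        * inv_qfact (qvar D)
            (int (min j k2) - int i2
             + 2 * (\<Sum>\<beta>\<in>I. int (s \<beta>) * (int \<beta> - int (min k1 \<beta>)))))"

text \<open>
  The tuples \<open>(s\<^sub>\<alpha>)\<close>, \<open>\<alpha> \<in> I\<close>, that occur in the limit. Such a tuple stems from the summands of the
  restricted Kostka polynomials in which \<open>2 |s| = |m(N)| - j\<close> determines the eliminated entry,
  \<open>s\<^sub>k\<^sub>1 = N + (i1 + i2 - j - 2 * (\<Sum>\<beta>\<in>I. \<beta> * s\<^sub>\<beta>)) / (2 * k1)\<close>,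
  and the divisibility condition says that this entry is an integer. It has to be required
  explicitly: the vanishing of \<open>q\<close>-binomials with non-integral entries does not imply it.
  For example, for \<open>k1 = 2\<close>, \<open>k2 = 1\<close>, \<open>i1 = i2 = j = 0\<close> and \<open>s\<^sub>1 = 0\<close>, \<open>s\<^sub>3 = 1\<close> the term is
  \<open>q^(3/2) / ((1 - q) * (1 - q^2))\<close>, whereas the Kostka polynomials involve integral powers of
  \<open>q\<close> only. If \<open>k1\<close> is odd and \<open>i1 + i2 - j\<close> is even, all non-zero terms satisfy the condition.
\<close>

definition summation_tuples ::
    "nat \<Rightarrow> nat \<Rightarrow> nat \<Rightarrow> nat \<Rightarrow> nat \<Rightarrow> (nat \<Rightarrow> nat) set" where
  "summation_tuples k1 k2 i1 i2 j =
     {s \<in> idx k1 k2 \<rightarrow>\<^sub>E (UNIV :: nat set).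
        2 * int k1 dvd int i1 + int i2 - int j - 2 * (\<Sum>\<beta>\<in>idx k1 k2. int \<beta> * int (s \<beta>))}"

end

theory Submission
  imports Defs
begin

text \<open>
  The constraint \<open>2 |s| = |m(N)| - j\<close> determines \<open>t = s\<^sub>k\<^sub>1 = N + const\<close> from the entries \<open>s\<^sub>\<alpha>\<close>,
  \<open>\<alpha> \<in> I\<close>. After this substitution a summand of the restricted Kostka polynomial depends on \<open>N\<close>
  only through the factor \<open>[P + t; t]\<^sub>q\<close> at position \<open>k1\<close>, which tends to \<open>1 / (P)\<^sub>q!\<close>; everything
  else is already the summand of the limit. The sum and the limit may be interchanged because the
  exponents \<open>sBs + us\<close> bound the orders of all summands from below independently of \<open>N\<close>, and only
  finitely many \<open>s\<close> have exponent below a given bound: \<open>B\<close> has nonnegative entries and its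
  diagonal is at least \<open>1 / k1\<close>.
\<close>

unbundle fps_syntax


section \<open>Convergence of formal Laurent series\<close>

text \<open>A bound on the order in \<open>z\<close>. The form
  \<open>n \<le> fls_subdegree f\<close> would exclude \<open>f = 0\<close> for positive
  \<open>n\<close>, since the subdegree of 0 is 0 by convention.\<close>

definition vanishes_below :: "'a::zero fls \<Rightarrow> int \<Rightarrow> bool" where
  "vanishes_below f n \<longleftrightarrow> (\<forall>m<n. f $$ m = 0)"

lemma vanishes_below_iff_subdegree: "vanishes_below f n \<longleftrightarrow> f = 0 \<or> n \<le> fls_subdegree f"
proof
  show "vanishes_below f n \<Longrightarrow> f = 0 \<or> n \<le> fls_subdegree f"
    using fls_subdegree_geI[of f n] by (auto simp: vanishes_below_def)
qed (auto simp: vanishes_below_def)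

lemma vanishes_below_0 [simp]: "vanishes_below 0 n"
  by (simp add: vanishes_below_def)

lemma vanishes_below_mono: "vanishes_below f n \<Longrightarrow> m \<le> n \<Longrightarrow> vanishes_below f m"
  by (auto simp: vanishes_below_def)

lemma vanishes_below_diff:
  fixes f g :: "'a::group_add fls"
  shows "vanishes_below f n \<Longrightarrow> vanishes_below g n \<Longrightarrow> vanishes_below (f - g) n"
  by (simp add: vanishes_below_def)

lemma vanishes_below_mult:
  fixes f g :: "'a::idom fls"
  assumes "vanishes_below f m" "vanishes_below g n"
  shows "vanishes_below (f * g) (m + n)"
  using assms by (cases "f = 0 \<or> g = 0") (auto simp: vanishes_below_iff_subdegree)

lemma vanishes_below_mult_0:
  fixes f g :: "'a::idom fls"
  assumes "vanishes_below f m" "vanishes_below g 0"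
  shows "vanishes_below (f * g) m"
  using vanishes_below_mult[OF assms] by simp

lemma vanishes_below_prod:
  fixes f :: "'b \<Rightarrow> 'a::idom fls"
  assumes "\<And>x. x \<in> A \<Longrightarrow> vanishes_below (f x) 0"
  shows "vanishes_below (\<Prod>x\<in>A. f x) 0"
  using assms
proof (induction A rule: infinite_finite_induct)
  case (insert x A)
  then show ?case using vanishes_below_mult_0[of "f x" 0 "prod f A"] by simp
qed (simp_all add: vanishes_below_iff_subdegree)

text \<open>For small distances the metric is 2 to the power of minus the subdegree of the
  difference, so agreement below every index is convergence.\<close>

lemma tendsto_flsI:
  fixes X :: "'b \<Rightarrow> 'a::group_add fls"
  assumes "\<And>n. \<forall>\<^sub>F x in F. vanishes_below (X x - L) n"
  shows "(X \<longlongrightarrow> L) F"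
proof (rule tendstoI)
  fix e :: real assume "e > 0"
  then obtain n where n: "inverse (2 ^ n) < e"
    using real_arch_pow_inv[of e "1/2"] by (auto simp: power_one_over inverse_eq_divide)
  show "\<forall>\<^sub>F x in F. dist (X x) L < e"
    using assms[of "int n"]
  proof eventually_elim
    case (elim x)
    show ?case
    proof (cases "X x = L")
      case False
      then have sub: "int n \<le> fls_subdegree (X x - L)"
        using elim by (simp add: vanishes_below_iff_subdegree)
      then have "dist (X x) L = inverse (2 ^ nat (fls_subdegree (X x - L)))"
        using False by (simp add: dist_fls_def)
      also have "\<dots> \<le> inverse (2 ^ n)"
        using sub by (intro le_imp_inverse_le power_increasing) auto
      finally show ?thesis using n by simp
    qed (use \<open>e > 0\<close> in simp)
  qed
qed

lemma fls_sum_nth: "(\<Sum>x\<in>A. f x) $$ n = (\<Sum>x\<in>A. f x $$ n)"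
  for f :: "'b \<Rightarrow> 'a::comm_monoid_add fls"
  by (induction A rule: infinite_finite_induct) auto

text \<open>The sum is built coefficientwise: at index \<open>n\<close> only the finitely many
  \<open>s\<close> with \<open>w s \<le> n\<close> can contribute.\<close>

lemma fls_has_sum:
  fixes f :: "'b \<Rightarrow> 'a::ab_group_add fls" and w :: "'b \<Rightarrow> int"
  assumes fin: "\<And>n. finite {s\<in>S. w s \<le> n}"
    and low: "\<And>s. s \<in> S \<Longrightarrow> vanishes_below (f s) (w s)"
  obtains L where "(f has_sum L) S"
    and "\<And>n. L $$ n = (\<Sum>s | s \<in> S \<and> w s \<le> n. f s $$ n)"
proof -
  define c where "c n = (\<Sum>s | s \<in> S \<and> w s \<le> n. f s $$ n)" for n
  \<comment> \<open>A lower bound for all weights, which makes \<open>c\<close> a Laurent series.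
    Inserting 0 makes the set nonempty and gives \<open>b \<le> 0\<close>.\<close>
  define b where "b = Min (insert 0 (w ` {s\<in>S. w s \<le> 0}))"
  have "c n = 0" if "n < b" for n
  proof -
    have b: "b \<le> w s" if "s \<in> S" "w s \<le> 0" for s
      unfolding b_def using fin[of 0] that by (auto intro!: Min_le)
    have "b \<le> 0" unfolding b_def using fin[of 0] by (auto intro!: Min_le)
    have "w s > n" if "s \<in> S" for s
      using b[of s] that \<open>n < b\<close> \<open>b \<le> 0\<close> by linarith
    then have "{s. s \<in> S \<and> w s \<le> n} = {}" by fastforce
    then show ?thesis by (simp only: c_def sum.empty)
  qed
  then have nth: "Abs_fls c $$ n = c n" for n
    by (intro nth_Abs_fls_lower_bound[of b]) auto
  have "(f has_sum Abs_fls c) S"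
    unfolding has_sum_def
  proof (rule tendsto_flsI)
    fix n
    define F where "F = {s\<in>S. w s \<le> n}"
    show "\<forall>\<^sub>F A in finite_subsets_at_top S. vanishes_below (sum f A - Abs_fls c) n"
      unfolding eventually_finite_subsets_at_top
    proof (intro exI[of _ F] conjI allI impI)
      fix A assume A: "finite A \<and> F \<subseteq> A \<and> A \<subseteq> S"
      have "(\<Sum>s\<in>A. f s $$ m) = c m" if "m < n" for m
        unfolding c_def
      proof (rule sum.mono_neutral_right)
        show "\<forall>s\<in>A - {s. s \<in> S \<and> w s \<le> m}. f s $$ m = 0"
        proof
          fix s assume "s \<in> A - {s. s \<in> S \<and> w s \<le> m}"
          then have "s \<in> S" "m < w s" using A by auto
          then show "f s $$ m = 0" using low[of s] by (simp add: vanishes_below_def)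
        qed
      qed (use A that in \<open>auto simp: F_def\<close>)
      then show "vanishes_below (sum f A - Abs_fls c) n"
        by (simp add: vanishes_below_def fls_sum_nth nth)
    qed (use fin F_def in auto)
  qed
  with nth that[of "Abs_fls c"] show ?thesis by (simp add: c_def)
qed

text \<open>The bound \<open>w\<close>, independent of \<open>N\<close>, acts as the dominating
  function: below index \<open>n\<close> only finitely many \<open>s\<close> matter, and for large
  \<open>N\<close> all of them lie in \<open>T N\<close> with the right coefficients.\<close>

lemma fls_dominated_convergence:
  fixes f :: "'b \<Rightarrow> 'a::ab_group_add fls" and w :: "'b \<Rightarrow> int"
  assumes fin: "\<And>n. finite {s\<in>S. w s \<le> n}"
    and low: "\<And>s. s \<in> S \<Longrightarrow> vanishes_below (f s) (w s)"
    and low_g: "\<And>N s. s \<in> S \<Longrightarrow> vanishes_below (g N s) (w s)"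
    and conv: "\<And>s n. s \<in> S \<Longrightarrow> \<forall>\<^sub>F N in sequentially. s \<in> T N \<and> vanishes_below (g N s - f s) n"
    and T: "\<And>N. finite (T N)" "\<And>N. T N \<subseteq> S"
  shows "f summable_on S" "(\<lambda>N. \<Sum>s\<in>T N. g N s) \<longlonglongrightarrow> (\<Sum>\<^sub>\<infinity>s\<in>S. f s)"
proof -
  obtain L where L: "(f has_sum L) S"
    and nth: "\<And>n. L $$ n = (\<Sum>s | s \<in> S \<and> w s \<le> n. f s $$ n)"
    using fls_has_sum[OF fin low] by blast
  show "f summable_on S" using L by (auto simp: summable_on_def)
  have "(\<lambda>N. \<Sum>s\<in>T N. g N s) \<longlonglongrightarrow> L"
  proof (rule tendsto_flsI)
    fix n
    have "\<forall>\<^sub>F N in sequentially. \<forall>s\<in>{s\<in>S. w s \<le> n}. s \<in> T N \<and> vanishes_below (g N s - f s) n"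
      using fin conv by (subst eventually_ball_finite_distrib) auto
    then show "\<forall>\<^sub>F N in sequentially. vanishes_below ((\<Sum>s\<in>T N. g N s) - L) n"
    proof eventually_elim
      case (elim N)
      have "(\<Sum>s\<in>T N. g N s $$ m) = (\<Sum>s | s \<in> S \<and> w s \<le> m. f s $$ m)" if "m < n" for m
      proof (rule sum.mono_neutral_cong_right)
        show "\<forall>s\<in>T N - {s. s \<in> S \<and> w s \<le> m}. g N s $$ m = 0"
        proof
          fix s assume "s \<in> T N - {s. s \<in> S \<and> w s \<le> m}"
          then have "s \<in> S" "m < w s" using T(2)[of N] by auto
          then show "g N s $$ m = 0" using low_g[of s N] by (simp add: vanishes_below_def)
        qed
      qed (use elim that T in \<open>auto simp: vanishes_below_def\<close>)
      then show ?case by (simp add: vanishes_below_def fls_sum_nth nth)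
    qed
  qed
  with L show "(\<lambda>N. \<Sum>s\<in>T N. g N s) \<longlonglongrightarrow> (\<Sum>\<^sub>\<infinity>s\<in>S. f s)"
    by (simp add: infsumI)
qed


section \<open>Powers of \<open>q\<close> and \<open>q\<close>-factorials\<close>

text \<open>The floor in \<open>qpow\<close> is not additive, but an integral summand can be pulled
  out of it.\<close>

lemma qpow_add:
  assumes "of_nat D * a \<in> \<int>"
  shows "qpow D (a + b) = qpow D a * qpow D b"
proof -
  from assms obtain n where "of_nat D * a = of_int n" by (auto elim: Ints_cases)
  then have "\<lfloor>of_nat D * (a + b)\<rfloor> = \<lfloor>of_nat D * a\<rfloor> + \<lfloor>of_nat D * b\<rfloor>"
    by (simp add: distrib_left)
  then show ?thesis
    unfolding qpow_def fls_X_intpow_times_fls_X_intpow by simp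
qed

lemma qpow_0 [simp]: "qpow D 0 = 1"
  by (simp add: qpow_def)

lemma vanishes_below_qpow: "vanishes_below (qpow D e) \<lfloor>of_nat D * e\<rfloor>"
  unfolding vanishes_below_iff_subdegree qpow_def fls_subdegree_fls_X_intpow by simp

lemma qvar_power: "qvar D ^ n = fls_X_intpow (int (D * n))"
  by (simp add: qvar_def fls_X_conv_shift_1 fls_X_intpow_power mult.commute)

lemma one_minus_qvar_power:
  assumes "D > 0" "n > 0"
  shows "1 - qvar D ^ n \<noteq> 0" "fls_subdegree (1 - qvar D ^ n) = 0"
proof -
  have nth: "(1 - qvar D ^ n) $$ 0 = 1"
    using assms by (simp add: qvar_power)
  then show "1 - qvar D ^ n \<noteq> 0" by auto
  have "fls_subdegree (1 - qvar D ^ n) \<le> 0"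
    using nth by (intro fls_subdegree_leI) simp
  moreover have "0 \<le> fls_subdegree (1 - qvar D ^ n)"
    using \<open>1 - qvar D ^ n \<noteq> 0\<close> by (intro fls_subdegree_geI) (auto simp: qvar_power simp del: of_nat_mult)
  ultimately show "fls_subdegree (1 - qvar D ^ n) = 0" by simp
qed

text \<open>Each factor \<open>1 - q^i\<close> has constant coefficient 1, so the factorial is a
  unit of the power series ring; hence q-binomials have no negative powers.\<close>

lemma qfact_qvar:
  assumes "D > 0"
  shows "qfact (qvar D) n \<noteq> 0" "fls_subdegree (qfact (qvar D) n) = 0"
proof -
  show "qfact (qvar D) n \<noteq> 0"
    using one_minus_qvar_power(1)[OF assms] by (auto simp: qfact_def)
  show "fls_subdegree (qfact (qvar D) n) = 0"
    unfolding qfact_def using one_minus_qvar_power[OF assms]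
    by (subst fls_subdegree_prod) auto
qed

lemma qfact_Suc: "qfact q (Suc n) = qfact q n * (1 - q ^ Suc n)"
  by (simp add: qfact_def)

lemma vanishes_below_qfact:
  assumes "D > 0"
  shows "vanishes_below (qfact (qvar D) n) 0" "vanishes_below (inverse (qfact (qvar D) n)) 0"
  using qfact_qvar[OF assms] by (simp_all add: vanishes_below_iff_subdegree)

lemma vanishes_below_qbinom:
  assumes "D > 0"
  shows "vanishes_below (qbinom (qvar D) x m) 0"
  using vanishes_below_qfact[OF assms]
  by (auto simp: qbinom_def divide_inverse intro!: vanishes_below_mult_0)

lemma vanishes_below_inv_qfact:
  assumes "D > 0"
  shows "vanishes_below (inv_qfact (qvar D) n) 0"
  using vanishes_below_qfact[OF assms] by (simp add: inv_qfact_def divide_inverse)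

text \<open>Passing from \<open>p\<close> to \<open>p + 1\<close> changes the factorial by
  \<open>q^(p+t+1)\<close> times a power series, a change of order at least
  \<open>t\<close>.\<close>

lemma vanishes_below_qfact_diff:
  assumes "D > 0"
  shows "vanishes_below (qfact (qvar D) (p + t) - qfact (qvar D) t) (int t)"
proof (induction p)
  case (Suc p)
  have "t \<le> D * Suc (p + t)"
    using assms by (cases D) auto
  then have "int t \<le> int (D * Suc (p + t))"
    by (simp only: of_nat_le_iff)
  then have "vanishes_below (qvar D ^ Suc (p + t)) (int t)"
    unfolding vanishes_below_iff_subdegree qvar_power fls_subdegree_fls_X_intpow by simp
  then have "vanishes_below (qvar D ^ Suc (p + t) * qfact (qvar D) (p + t)) (int t)"
    by (rule vanishes_below_mult_0) (rule vanishes_below_qfact[OF assms])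
  with Suc have "vanishes_below (qfact (qvar D) (p + t) - qfact (qvar D) t
      - qvar D ^ Suc (p + t) * qfact (qvar D) (p + t)) (int t)"
    by (rule vanishes_below_diff)
  then show ?case by (simp only: add_Suc qfact_Suc) (simp add: algebra_simps)
qed simp

lemma qbinom_of_nat:
  "qbinom q (of_nat n) m = (if m \<le> n then qfact q n / (qfact q m * qfact q (n - m)) else 0)"
  by (simp add: qbinom_def)

lemma qbinom_of_int_add:
  "qbinom q (of_int p + of_nat t) t =
    (if p < 0 then 0 else qfact q (nat p + t) / (qfact q t * qfact q (nat p)))"
proof (cases "p < 0")
  case False
  then have "of_int p + of_nat t = (of_nat (nat p + t) :: rat)" by simp
  then show ?thesis using False by (simp add: qbinom_of_nat del: of_nat_add)
qed (simp add: qbinom_def)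

text \<open>For \<open>p \<ge> 0\<close> the difference is \<open>(p+t)_q! - (t)_q!\<close> divided
  by the unit \<open>(t)_q! (p)_q!\<close>. For \<open>p < 0\<close> both terms are 0 by
  convention.\<close>

lemma qbinom_tendsto_inv_qfact:
  assumes "D > 0"
  shows "vanishes_below (qbinom (qvar D) (of_int p + of_nat t) t - inv_qfact (qvar D) p) (int t)"
proof (cases "p < 0")
  case False
  let ?f = "qfact (qvar D)"
  have "qbinom (qvar D) (of_int p + of_nat t) t - inv_qfact (qvar D) p
      = (?f (nat p + t) - ?f t) * (inverse (?f t) * inverse (?f (nat p)))"
    using False qfact_qvar[OF assms]
    by (simp add: qbinom_of_int_add inv_qfact_def field_simps)
  also have "vanishes_below \<dots> (int t)"
    by (intro vanishes_below_mult_0 vanishes_below_qfact vanishes_below_qfact_diff assms)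
  finally show ?thesis .
qed (simp add: qbinom_of_int_add inv_qfact_def)


section \<open>Growth of the exponent\<close>

text \<open>The matrix \<open>B\<close> is block diagonal with blocks \<open>min \<alpha> \<beta> - \<alpha> \<beta> / k1\<close> for \<open>\<alpha>, \<beta> < k1\<close> and
  \<open>min a b + a b / k1\<close> for \<open>\<alpha> = k1 + a\<close>, \<open>\<beta> = k1 + b\<close>.\<close>

lemma B_coeff_nonneg:
  assumes "k1 \<ge> 1"
  shows "0 \<le> B_coeff k1 \<alpha> \<beta>"
proof -
  have *: "0 \<le> B_coeff k1 \<alpha> \<beta>" if "\<alpha> \<le> \<beta>" for \<alpha> \<beta>
  proof -
    consider "\<beta> \<le> k1" | "\<alpha> \<le> k1" "k1 < \<beta>" | "k1 < \<alpha>" using \<open>\<alpha> \<le> \<beta>\<close> by linarith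
    then show ?thesis
    proof cases
      case 1
      then have "\<alpha> * \<beta> \<le> \<alpha> * k1" by simp
      then have "of_nat \<alpha> * of_nat \<beta> \<le> (of_nat \<alpha> * of_nat k1 :: rat)"
        by (metis of_nat_le_iff of_nat_mult)
      with 1 that assms show ?thesis by (simp add: B_coeff_def field_simps)
    next
      case 2
      with that assms show ?thesis by (simp add: B_coeff_def field_simps)
    next
      case 3
      then have "k1 * \<beta> \<le> \<alpha> * \<beta>" by simp
      then have "of_nat k1 * of_nat \<beta> \<le> (of_nat \<alpha> * of_nat \<beta> :: rat)"
        by (metis of_nat_le_iff of_nat_mult)
      with 3 that assms show ?thesis by (simp add: B_coeff_def field_simps)
    qed
  qed
  have "B_coeff k1 \<alpha> \<beta> = B_coeff k1 \<beta> \<alpha>"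
    by (simp add: B_coeff_def min.commute algebra_simps)
  with * show ?thesis by (metis nat_le_linear)
qed

text \<open>The entry equals \<open>\<alpha> |\<alpha> - k1| / k1\<close>, whose numerator is a
  positive integer.\<close>

lemma B_coeff_diag_ge:
  assumes "k1 \<ge> 1" "\<alpha> \<ge> 1" "\<alpha> \<noteq> k1"
  shows "1 / of_nat k1 \<le> B_coeff k1 \<alpha> \<alpha>"
proof (cases "\<alpha> < k1")
  case True
  then obtain d where "k1 = \<alpha> + Suc d" using less_imp_Suc_add by auto
  moreover have "1 \<le> \<alpha> * Suc d" using assms by (cases \<alpha>) auto
  then have "1 \<le> of_nat \<alpha> * (of_nat (Suc d) :: rat)"
    by (metis of_nat_1 of_nat_le_iff of_nat_mult)
  ultimately show ?thesis using assms True by (simp add: B_coeff_def field_simps)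
next
  case False
  then obtain d where "\<alpha> = k1 + Suc d" using assms less_imp_Suc_add[of k1 \<alpha>] by auto
  moreover have "1 \<le> \<alpha> * Suc d" using assms by (cases \<alpha>) auto
  then have "1 \<le> of_nat \<alpha> * (of_nat (Suc d) :: rat)"
    by (metis of_nat_1 of_nat_le_iff of_nat_mult)
  ultimately show ?thesis using assms False by (simp add: B_coeff_def field_simps)
qed

definition limit_exponent ::
    "nat \<Rightarrow> nat \<Rightarrow> nat \<Rightarrow> nat \<Rightarrow> nat \<Rightarrow> (nat \<Rightarrow> nat) \<Rightarrow> rat" where
  "limit_exponent k1 k2 i1 i2 j s =
     (\<Sum>\<alpha>\<in>idx k1 k2. \<Sum>\<beta>\<in>idx k1 k2. B_coeff k1 \<alpha> \<beta> * of_nat (s \<alpha>) * of_nat (s \<beta>))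
     + (\<Sum>\<alpha>\<in>idx k1 k2. u_coeff k1 i1 i2 j \<alpha> * of_nat (s \<alpha>))"

lemma finite_idx [simp]: "finite (idx k1 k2)"
  by (simp add: idx_def)

text \<open>Dropping the nonnegative off-diagonal terms leaves at least
  \<open>s_\<alpha>^2 / k1\<close> for each index, which outgrows the linear part.\<close>

lemma limit_exponent_ge:
  assumes "k1 \<ge> 1"
  obtains K where
    "\<And>s. (\<Sum>\<alpha>\<in>idx k1 k2. of_nat (s \<alpha>)) - K \<le> limit_exponent k1 k2 i1 i2 j s"
proof -
  let ?I = "idx k1 k2" and ?u = "u_coeff k1 i1 i2 j"
  \<comment> \<open>Completes the square: \<open>(s - c)^2 / k1 \<ge> 0\<close> says
    \<open>s^2 / k1 + u s \<ge> s - c^2 / k1\<close>.\<close>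
  define c where "c \<alpha> = of_nat k1 * (1 - ?u \<alpha>) / 2" for \<alpha>
  have "(\<Sum>\<alpha>\<in>?I. of_nat (s \<alpha>)) - (\<Sum>\<alpha>\<in>?I. c \<alpha> ^ 2 / of_nat k1)
      \<le> limit_exponent k1 k2 i1 i2 j s" for s
  proof -
    have diag: "of_nat (s \<alpha>) ^ 2 / of_nat k1
        \<le> (\<Sum>\<beta>\<in>?I. B_coeff k1 \<alpha> \<beta> * of_nat (s \<alpha>) * of_nat (s \<beta>))" if \<alpha>: "\<alpha> \<in> ?I" for \<alpha>
    proof -
      have "1 / of_nat k1 * of_nat (s \<alpha>) ^ 2 \<le> B_coeff k1 \<alpha> \<alpha> * of_nat (s \<alpha>) ^ 2"
        using B_coeff_diag_ge[of k1 \<alpha>] \<alpha> assms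
        by (intro mult_right_mono) (auto simp: idx_def)
      also have "\<dots> = B_coeff k1 \<alpha> \<alpha> * of_nat (s \<alpha>) * of_nat (s \<alpha>)"
        by (simp add: power2_eq_square)
      also have "\<dots> \<le> (\<Sum>\<beta>\<in>?I. B_coeff k1 \<alpha> \<beta> * of_nat (s \<alpha>) * of_nat (s \<beta>))"
        using \<alpha> B_coeff_nonneg[OF assms] by (intro member_le_sum) auto
      finally show ?thesis by simp
    qed
    have "of_nat (s \<alpha>) - c \<alpha> ^ 2 / of_nat k1
        \<le> (\<Sum>\<beta>\<in>?I. B_coeff k1 \<alpha> \<beta> * of_nat (s \<alpha>) * of_nat (s \<beta>)) + ?u \<alpha> * of_nat (s \<alpha>)"
      if "\<alpha> \<in> ?I" for \<alpha>
    proof -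
      have "0 \<le> (of_nat (s \<alpha>) - c \<alpha>) ^ 2 / of_nat k1" by simp
      also have "\<dots> = of_nat (s \<alpha>) ^ 2 / of_nat k1 + ?u \<alpha> * of_nat (s \<alpha>)
          - (of_nat (s \<alpha>) - c \<alpha> ^ 2 / of_nat k1)"
        using assms by (simp add: c_def power2_eq_square field_simps)
      finally show ?thesis using diag[OF that] by linarith
    qed
    then have "(\<Sum>\<alpha>\<in>?I. of_nat (s \<alpha>) - c \<alpha> ^ 2 / of_nat k1)
        \<le> (\<Sum>\<alpha>\<in>?I. (\<Sum>\<beta>\<in>?I. B_coeff k1 \<alpha> \<beta> * of_nat (s \<alpha>) * of_nat (s \<beta>))
            + ?u \<alpha> * of_nat (s \<alpha>))"
      by (rule sum_mono)
    then show ?thesis by (simp add: limit_exponent_def sum.distrib sum_subtractf)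
  qed
  then show ?thesis using that by blast
qed

lemma finite_limit_exponent_le:
  assumes "k1 \<ge> 1"
  shows "finite {s \<in> idx k1 k2 \<rightarrow>\<^sub>E (UNIV :: nat set). limit_exponent k1 k2 i1 i2 j s \<le> M}"
proof -
  obtain K where K: "\<And>s. (\<Sum>\<alpha>\<in>idx k1 k2. of_nat (s \<alpha>)) - K \<le> limit_exponent k1 k2 i1 i2 j s"
    using limit_exponent_ge[OF assms] by blast
  define b where "b = nat \<lfloor>M + K\<rfloor>"
  have "s \<alpha> \<le> b" if "limit_exponent k1 k2 i1 i2 j s \<le> M" "\<alpha> \<in> idx k1 k2" for s \<alpha>
  proof -
    have "(of_nat (s \<alpha>) :: rat) \<le> (\<Sum>\<alpha>\<in>idx k1 k2. of_nat (s \<alpha>))"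
      using that by (intro member_le_sum) auto
    also have "\<dots> \<le> M + K" using K[of s] that by simp
    finally have "int (s \<alpha>) \<le> \<lfloor>M + K\<rfloor>" by (simp add: le_floor_iff)
    then show ?thesis by (simp add: b_def)
  qed
  then have "{s \<in> idx k1 k2 \<rightarrow>\<^sub>E UNIV. limit_exponent k1 k2 i1 i2 j s \<le> M} \<subseteq> idx k1 k2 \<rightarrow>\<^sub>E {..b}"
    by (auto simp: PiE_iff extensional_def)
  then show ?thesis by (rule finite_subset) (simp add: finite_PiE)
qed


section \<open>Elimination of \<open>s\<^sub>k\<^sub>1\<close>\<close>

locale fusion_data =
  fixes k1 k2 i1 i2 j :: nat
  assumes k1: "k1 \<ge> 1" and i1: "i1 \<le> k1" and i2: "i2 \<le> k2"
begin

abbreviation "I \<equiv> idx k1 k2"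
abbreviation "S \<equiv> summation_tuples k1 k2 i1 i2 j"
abbreviation "m \<equiv> fusion_tuple k1 i1 i2"

definition weight :: "(nat \<Rightarrow> nat) \<Rightarrow> int" where
  "weight r = (\<Sum>\<beta>\<in>I. int \<beta> * int (r \<beta>))"

text \<open>The difference \<open>s\<^sub>k\<^sub>1 - N\<close>.\<close>

definition shift :: "(nat \<Rightarrow> nat) \<Rightarrow> int" where
  "shift r = (int i1 + int i2 - int j - 2 * weight r) div (2 * int k1)"

text \<open>In the limit this indexes the factorial in the denominator; for finite \<open>N\<close>
  it is the \<open>P\<close> of the binomial \<open>[P + t; t]\<close> at position
  \<open>k1\<close>.\<close>

definition qindex :: "(nat \<Rightarrow> nat) \<Rightarrow> int" where
  "qindex r = int (min j k2) - int i2 + 2 * (\<Sum>\<beta>\<in>I. int (r \<beta>) * (int \<beta> - int (min k1 \<beta>)))"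

text \<open>The factor shared by the limit and the finite summands.\<close>

definition prefactor :: "(nat \<Rightarrow> nat) \<Rightarrow> rat fls" where
  "prefactor r = qpow (4 * k1) (limit_exponent k1 k2 i1 i2 j r)
     * (\<Prod>\<alpha>\<in>I. qbinom (qvar (4 * k1))
          ((\<Sum>\<beta>\<in>I. C_coeff k1 \<alpha> \<beta> * of_nat (r \<beta>)) + v_coeff k1 k2 i1 i2 j \<alpha> + of_nat (r \<alpha>))
          (r \<alpha>))"

text \<open>A normalised Kostka summand in terms of the remaining entries; \<open>nat\<close>
  truncates only outside \<open>finite_tuples N\<close>.\<close>

definition finite_term :: "nat \<Rightarrow> (nat \<Rightarrow> nat) \<Rightarrow> rat fls" where
  "finite_term N r = prefactor r
     * (let t = nat (int N + shift r) in
          qbinom (qvar (4 * k1)) (of_int (qindex r) + of_nat t) t)"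

definition finite_tuples :: "nat \<Rightarrow> (nat \<Rightarrow> nat) set" where
  "finite_tuples N = {r \<in> S. 0 \<le> int N + shift r}"

lemma limit_term_eq:
  "limit_term (4 * k1) k1 k2 i1 i2 j r = prefactor r * inv_qfact (qvar (4 * k1)) (qindex r)"
  by (simp add: limit_term_def Let_def prefactor_def limit_exponent_def qindex_def)

lemma shift:
  assumes "r \<in> S"
  shows "2 * int k1 * shift r = int i1 + int i2 - int j - 2 * weight r"
  using assms by (simp add: summation_tuples_def shift_def weight_def)

section \<open>Splitting off position \<open>k1\<close>; weight and parity count of the fusion
  tuple\<close>

lemma insert_idx: "{1..k1 + k2} = insert k1 I" "k1 \<notin> I"
  using k1 by (auto simp: idx_def)

lemma sum_idx: "(\<Sum>a=1..k1 + k2. h a) = h k1 + (\<Sum>a\<in>I. h a)"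
  for h :: "nat \<Rightarrow> 'b::comm_monoid_add"
  using insert_idx by simp

lemma prod_idx: "(\<Prod>a=1..k1 + k2. h a) = h k1 * (\<Prod>a\<in>I. h a)"
  for h :: "nat \<Rightarrow> 'b::comm_monoid_mult"
  using insert_idx by simp

text \<open>The condition \<open>f 0 = 0\<close> makes the formula cover \<open>i = 0\<close>, where
  the tuple is zero.\<close>

lemma sum_unit_tuple:
  fixes f :: "nat \<Rightarrow> rat"
  assumes "f 0 = 0" "i \<le> k"
  shows "(\<Sum>a=1..k. f a * of_nat (unit_tuple i a)) = f i"
proof (cases "i = 0")
  case False
  then have "(\<Sum>a=1..k. f a * of_nat (unit_tuple i a)) = (\<Sum>a=1..k. if a = i then f a else 0)"
    by (intro sum.cong) (auto simp: unit_tuple_def)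
  also have "\<dots> = f i" using False assms by simp
  finally show ?thesis .
qed (use assms in \<open>simp add: unit_tuple_def\<close>)

lemma sum_fusion_tuple:
  fixes f :: "nat \<Rightarrow> rat"
  assumes "f 0 = 0" "N \<ge> 1"
  shows "(\<Sum>a=1..k1 + k2. f a * of_nat (m N a)) = f i1 + (2 * of_nat N - 1) * f k1 + f (k1 + i2)"
proof -
  \<comment> \<open>With \<open>N \<ge> 1\<close> the truncated \<open>2 * N - 1\<close> is a true
    difference.\<close>
  have "of_nat (m N a) = of_nat (unit_tuple i1 a)
      + (2 * of_nat N - 1) * of_nat (unit_tuple k1 a) + (of_nat (unit_tuple (k1 + i2) a) :: rat)" for a
    using assms(2) by (simp add: fusion_tuple_def of_nat_diff)
  then have "(\<Sum>a=1..k1 + k2. f a * of_nat (m N a))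
      = (\<Sum>a=1..k1 + k2. f a * of_nat (unit_tuple i1 a))
        + (2 * of_nat N - 1) * (\<Sum>a=1..k1 + k2. f a * of_nat (unit_tuple k1 a))
        + (\<Sum>a=1..k1 + k2. f a * of_nat (unit_tuple (k1 + i2) a))"
    by (simp add: sum_distrib_left distrib_left mult.left_commute flip: sum.distrib)
  then show ?thesis
    using i1 i2 assms(1) by (simp only: sum_unit_tuple trans_le_add1 add_le_cancel_left le_add1)
qed

lemma tuple_weight_fusion:
  assumes "N \<ge> 1"
  shows "tuple_weight (k1 + k2) (m N) = i1 + i2 + 2 * N * k1"
proof -
  have "(of_nat (tuple_weight (k1 + k2) (m N)) :: rat) = of_nat (i1 + i2 + 2 * N * k1)"
    using sum_fusion_tuple[of of_nat N] assms by (simp add: tuple_weight_def algebra_simps)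
  then show ?thesis by (simp only: of_nat_eq_iff)
qed

text \<open>For \<open>a \<le> k1\<close> the \<open>2N - 1\<close> middle factors and the last one
  add up to an even number, so the tail is odd iff \<open>a \<le> i1\<close>; beyond
  \<open>k1\<close> only the last factor is left.\<close>

lemma tuple_p_fusion:
  assumes "N \<ge> 1"
  shows "tuple_p (k1 + k2) (m N) = i1 + i2"
proof -
  have tail: "(\<Sum>b=a..k1 + k2. m N b) = (if a \<le> i1 then 1 else 0)
      + (2 * N - 1) * (if a \<le> k1 then 1 else 0) + (if a \<le> k1 + i2 then 1 else 0)"
    if "a \<ge> 1" for a
  proof -
    have "(\<Sum>b=a..k1 + k2. unit_tuple i b) = (if a \<le> i then 1 else 0)" if "i \<le> k1 + k2" for i
    proof -
      have "(\<Sum>b=a..k1 + k2. unit_tuple i b) = (\<Sum>b=a..k1 + k2. if b = i then 1 else 0)"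
        using \<open>a \<ge> 1\<close> by (intro sum.cong) (auto simp: unit_tuple_def)
      then show ?thesis using that by simp
    qed
    then show ?thesis
      using i1 i2 by (simp add: fusion_tuple_def sum.distrib flip: sum_distrib_left)
  qed
  have "{a \<in> {1..k1 + k2}. odd (\<Sum>b=a..k1 + k2. m N b)} = {1..i1} \<union> {k1 + 1..k1 + i2}"
    using tail i1 i2 assms by (auto split: if_splits)
  moreover have "{1..i1} \<inter> {k1 + 1..k1 + i2} = {}" using i1 by auto
  ultimately show ?thesis by (simp add: tuple_p_def card_Un_disjoint)
qed

section \<open>Exponent and binomial entries after the substitution\<close>

context
  fixes N :: nat and s :: "nat \<Rightarrow> nat" and \<tau> :: rat
  assumes N: "N \<ge> 1"
    and \<tau>: "of_nat (s k1) = of_nat N + \<tau>"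
    and weight_eq: "2 * of_nat k1 * \<tau> = of_nat i1 + of_nat i2 - of_nat j - 2 * of_int (weight s)"
begin

abbreviation "x \<equiv> \<lambda>a. of_nat (m N a) - 2 * of_nat (s a) :: rat"

text \<open>Here \<open>N\<close> cancels: the coefficient of \<open>f k1\<close> is
  \<open>(2N - 1) - 2(N + \<tau>) = -(2\<tau> + 1)\<close>. Taking \<open>\<tau>\<close> rational
  turns what follows into identities over a field.\<close>

lemma sum_x:
  assumes "f 0 = 0"
  shows "(\<Sum>a=1..k1 + k2. f a * x a)
    = f i1 + f (k1 + i2) - (2 * \<tau> + 1) * f k1 - 2 * (\<Sum>a\<in>I. f a * of_nat (s a))"
proof -
  have "(\<Sum>a=1..k1 + k2. f a * x a) = (\<Sum>a=1..k1 + k2. f a * of_nat (m N a))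
      - 2 * (\<Sum>a=1..k1 + k2. f a * of_nat (s a))"
    by (simp add: sum_subtractf sum_distrib_left algebra_simps)
  also have "(\<Sum>a=1..k1 + k2. f a * of_nat (s a)) = f k1 * of_nat (s k1) + (\<Sum>a\<in>I. f a * of_nat (s a))"
    by (rule sum_idx)
  finally show ?thesis
    using sum_fusion_tuple[of f N] assms N by (simp add: \<tau> algebra_simps)
qed

lemma A_vec_x:
  "A_vec (k1 + k2) x a = of_nat (min a i1) + of_nat (min a (k1 + i2))
     - (2 * \<tau> + 1) * of_nat (min a k1) - 2 * (\<Sum>b\<in>I. of_nat (min a b) * of_nat (s b))"
  unfolding A_vec_def by (rule sum_x) simp

lemma tau_eq: "\<tau> = (of_nat i1 + of_nat i2 - of_nat j - 2 * of_int (weight s)) / (2 * of_nat k1)"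
  using weight_eq k1 by (simp add: field_simps)

lemma of_int_weight: "of_int (weight s) = (\<Sum>b\<in>I. of_nat b * of_nat (s b) :: rat)"
  by (simp add: weight_def)

text \<open>Inserting the value of \<open>\<tau>\<close> into
  \<open>-(2\<tau> + 1) min(\<alpha>, k1)\<close> produces the fractions with denominator
  \<open>k1\<close> in \<open>C\<close> and \<open>v\<close>.\<close>

lemma A_vec_idx:
  "A_vec (k1 + k2) x \<alpha> - of_int (nu (k1 + k2) j \<alpha>)
    = (\<Sum>\<beta>\<in>I. C_coeff k1 \<alpha> \<beta> * of_nat (s \<beta>)) + v_coeff k1 k2 i1 i2 j \<alpha>"
proof -
  have nu: "(of_int (nu (k1 + k2) j \<alpha>) :: rat) = max 0 (of_nat \<alpha> - of_nat k1 - of_nat k2 + of_nat j)"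
    by (simp add: nu_def of_int_max)
  have C: "(\<Sum>\<beta>\<in>I. C_coeff k1 \<alpha> \<beta> * of_nat (s \<beta>))
      = 2 * of_nat (min \<alpha> k1) / of_nat k1 * of_int (weight s)
        - 2 * (\<Sum>b\<in>I. of_nat (min \<alpha> b) * of_nat (s b))"
    by (simp add: C_coeff_def of_int_weight sum_distrib_left left_diff_distrib sum_subtractf
        mult.assoc)
  show ?thesis
    unfolding A_vec_x nu v_coeff_def tau_eq C using k1 by (simp add: field_simps)
qed

text \<open>At position \<open>k1\<close> the factor \<open>min(k1, k1)\<close> clears the
  denominator of \<open>\<tau>\<close>, so the entry is an integer.\<close>

lemma A_vec_k1:
  "A_vec (k1 + k2) x k1 - of_int (nu (k1 + k2) j k1) = of_int (qindex s)"
proof -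
  have "(of_int (qindex s) :: rat) = of_nat (min j k2) - of_nat i2 + 2 * of_int (weight s)
      - 2 * (\<Sum>b\<in>I. of_nat (min k1 b) * of_nat (s b))"
    by (simp add: qindex_def of_int_weight algebra_simps sum_subtractf)
  \<comment> \<open>Here \<open>nu\<close> is \<open>max(0, j - k2)\<close>; subtracting it turns
    \<open>j\<close> into \<open>min(j, k2)\<close>.\<close>
  moreover have "of_int (nu (k1 + k2) j k1) = (of_nat j - of_nat (min j k2) :: rat)"
    by (auto simp: nu_def min_def max_def)
  ultimately show ?thesis
    unfolding A_vec_x using weight_eq i1 by (simp add: algebra_simps)
qed

text \<open>The form is a quarter of the sum of \<open>(A x)_a x_a\<close>, so \<open>sum_x\<close>
  applies twice: to the outer sum, and inside \<open>A_vec\<close>.\<close>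

lemma A_form_x:
  "A_form (k1 + k2) (\<lambda>a. of_nat (m N a) / 2 - of_nat (s a))
    = limit_exponent k1 k2 i1 i2 j s
      + (of_nat i1 + of_nat i2 - of_nat j) * (of_nat i2 - of_nat i1 - of_nat j) / (4 * of_nat k1)
      + of_nat (tuple_p (k1 + k2) (m N)) / 4"
proof -
  let ?A = "A_vec (k1 + k2) x"
  \<comment> \<open>These sums stay opaque, so that the claim becomes an identity of rational
    functions in them.\<close>
  define P where "P = (\<Sum>a\<in>I. of_nat (min a i1) * of_nat (s a) :: rat)"
  define R where "R = (\<Sum>a\<in>I. of_nat (min a (k1 + i2)) * of_nat (s a) :: rat)"
  define M where "M = (\<Sum>a\<in>I. of_nat (min a k1) * of_nat (s a) :: rat)"
  define W where "W = (\<Sum>a\<in>I. of_nat a * of_nat (s a) :: rat)"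
  define Q where
    "Q = (\<Sum>a\<in>I. \<Sum>b\<in>I. of_nat (min a b) * of_nat (s a) * of_nat (s b) :: rat)"
  have "A_form (k1 + k2) (\<lambda>a. of_nat (m N a) / 2 - of_nat (s a))
      = (\<Sum>a=1..k1 + k2. ?A a * x a) / 4"
    unfolding A_form_def A_vec_def sum_distrib_right sum_divide_distrib
    by (intro sum.cong) (simp_all add: field_simps)
  also have "(\<Sum>a=1..k1 + k2. ?A a * x a)
      = ?A i1 + ?A (k1 + i2) - (2 * \<tau> + 1) * ?A k1 - 2 * (\<Sum>a\<in>I. ?A a * of_nat (s a))"
    by (rule sum_x) (simp add: A_vec_def)
  also have "(\<Sum>a\<in>I. ?A a * of_nat (s a)) = P + R - (2 * \<tau> + 1) * M - 2 * Q"
    unfolding A_vec_x P_def R_def M_def Q_def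
    by (simp add: algebra_simps sum.distrib sum_subtractf sum_distrib_left)
  also have "?A i1 = 2 * of_nat i1 - (2 * \<tau> + 1) * of_nat i1 - 2 * P"
    unfolding A_vec_x P_def using i1 by (simp add: min.commute min_absorb1)
  also have "?A (k1 + i2) = of_nat i1 + of_nat (k1 + i2) - (2 * \<tau> + 1) * of_nat k1 - 2 * R"
    unfolding A_vec_x R_def using i1 by (simp add: min.commute)
  also have "?A k1 = of_nat i1 + of_nat k1 - (2 * \<tau> + 1) * of_nat k1 - 2 * M"
    unfolding A_vec_x M_def using i1 by (simp add: min.commute)
  finally have form: "A_form (k1 + k2) (\<lambda>a. of_nat (m N a) / 2 - of_nat (s a)) =
     (2 * of_nat i1 - (2 * \<tau> + 1) * of_nat i1 - 2 * P
      + (of_nat i1 + of_nat (k1 + i2) - (2 * \<tau> + 1) * of_nat k1 - 2 * R)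
      - (2 * \<tau> + 1) * (of_nat i1 + of_nat k1 - (2 * \<tau> + 1) * of_nat k1 - 2 * M)
      - 2 * (P + R - (2 * \<tau> + 1) * M - 2 * Q)) / 4" .
  have B: "(\<Sum>\<alpha>\<in>I. \<Sum>\<beta>\<in>I. B_coeff k1 \<alpha> \<beta> * of_nat (s \<alpha>) * of_nat (s \<beta>))
      = Q + (W * W - 2 * M * W) / of_nat k1"
  proof -
    have "(\<Sum>\<alpha>\<in>I. \<Sum>\<beta>\<in>I. B_coeff k1 \<alpha> \<beta> * of_nat (s \<alpha>) * of_nat (s \<beta>))
      = (\<Sum>\<alpha>\<in>I. \<Sum>\<beta>\<in>I. of_nat (min \<alpha> \<beta>) * of_nat (s \<alpha>) * of_nat (s \<beta>)
         + ((of_nat \<alpha> * of_nat (s \<alpha>)) * (of_nat \<beta> * of_nat (s \<beta>))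
         - (of_nat (min \<alpha> k1) * of_nat (s \<alpha>)) * (of_nat \<beta> * of_nat (s \<beta>))
         - (of_nat \<alpha> * of_nat (s \<alpha>)) * (of_nat (min \<beta> k1) * of_nat (s \<beta>))) / of_nat k1)"
      by (intro sum.cong refl) (use k1 in \<open>simp add: B_coeff_def field_simps\<close>)
    also have "\<dots> = Q + (W * W - M * W - W * M) / of_nat k1"
      by (simp only: sum.distrib sum_subtractf Q_def W_def M_def flip: sum_divide_distrib sum_product)
    finally show ?thesis by (simp add: algebra_simps)
  qed
  have u: "(\<Sum>\<alpha>\<in>I. u_coeff k1 i1 i2 j \<alpha> * of_nat (s \<alpha>))
      = - P - R + (M * (of_nat i1 + of_nat i2 - of_nat j + of_nat k1) + W * (of_nat j - of_nat i2))
          / of_nat k1"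
  proof -
    have "u_coeff k1 i1 i2 j \<alpha> * of_nat (s \<alpha>) = - (of_nat (min \<alpha> i1) * of_nat (s \<alpha>))
        - of_nat (min \<alpha> (k1 + i2)) * of_nat (s \<alpha>)
        + (of_nat (min \<alpha> k1) * of_nat (s \<alpha>) * (of_nat i1 + of_nat i2 - of_nat j + of_nat k1)
           + of_nat \<alpha> * of_nat (s \<alpha>) * (of_nat j - of_nat i2)) / of_nat k1" for \<alpha>
      using k1 by (simp add: u_coeff_def field_simps)
    then show ?thesis
      by (simp only: sum.distrib sum_subtractf sum_negf P_def R_def M_def W_def
          flip: sum_divide_distrib sum_distrib_right)
  qed
  have W: "of_int (weight s) = W" by (simp add: of_int_weight W_def)
  define K where "K = (of_nat k1 :: rat)"
  have "K \<noteq> 0" using k1 by (simp add: K_def)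
  \<comment> \<open>Solving for \<open>j\<close> instead of \<open>\<tau>\<close> brings in no new
    division.\<close>
  have j': "of_nat j = of_nat i1 + of_nat i2 - 2 * W - 2 * K * \<tau>"
    using weight_eq W by (simp add: K_def)
  show ?thesis
    unfolding form limit_exponent_def B u tuple_p_fusion[OF N] of_nat_add K_def[symmetric] j'
    using \<open>K \<noteq> 0\<close> by (simp add: field_simps power2_eq_square)
qed

end


section \<open>Matching the Kostka summands with the remaining entries\<close>

lemma finite_term_eq:
  assumes N: "N \<ge> 1" and r: "r \<in> S"
    and t: "int t = int N + shift r" and s: "\<And>\<alpha>. \<alpha> \<in> I \<Longrightarrow> s \<alpha> = r \<alpha>" "s k1 = t"
  shows "finite_term N r = qpow (4 * k1)
           (- ((of_nat i1 + of_nat i2 - of_nat j) * (of_nat i2 - of_nat i1 - of_nat j))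
            / (4 * of_nat k1))
         * (qpow (4 * k1) (A_form (k1 + k2) (\<lambda>a. of_nat (m N a) / 2 - of_nat (s a)))
        * (\<Prod>a=1..k1 + k2. qbinom (qvar (4 * k1))
             (A_vec (k1 + k2) (\<lambda>b. of_nat (m N b) - 2 * of_nat (s b)) a
                - of_int (nu (k1 + k2) j a) + of_nat (s a))
             (s a))) / qpow (4 * k1) (of_nat (tuple_p (k1 + k2) (m N)) / 4)"
proof -
  define \<tau> :: rat where "\<tau> = of_int (shift r)"
  define c :: rat where
    "c = (of_nat i1 + of_nat i2 - of_nat j) * (of_nat i2 - of_nat i1 - of_nat j) / (4 * of_nat k1)"
  have ws: "weight s = weight r" and qs: "qindex s = qindex r"
    and es: "limit_exponent k1 k2 i1 i2 j s = limit_exponent k1 k2 i1 i2 j r"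
    and Cs: "\<And>\<alpha>. (\<Sum>\<beta>\<in>I. C_coeff k1 \<alpha> \<beta> * of_nat (s \<beta>)) = (\<Sum>\<beta>\<in>I. C_coeff k1 \<alpha> \<beta> * of_nat (r \<beta>))"
    using s by (simp_all add: weight_def qindex_def limit_exponent_def)
  have \<tau>: "of_nat (s k1) = of_nat N + \<tau>"
    unfolding \<tau>_def s(2) using t by (metis of_int_add of_int_of_nat_eq)
  have weight_eq: "2 * of_nat k1 * \<tau> = of_nat i1 + of_nat i2 - of_nat j - 2 * of_int (weight s)"
    using arg_cong[OF shift[OF r], of "of_int :: int \<Rightarrow> rat"] by (simp add: \<tau>_def ws)
  note facts = N \<tau> weight_eq
  \<comment> \<open>The choice \<open>D = 4 k1\<close> clears the denominators of both normalising
    exponents, as \<open>qpow_add\<close> requires.\<close>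
  have int_c: "of_nat (4 * k1) * - c \<in> \<int>"
  proof -
    have "of_nat (4 * k1) * - c
        = of_int (- ((int i1 + int i2 - int j) * (int i2 - int i1 - int j)))"
      using k1 by (simp add: c_def)
    then show ?thesis by (simp only: Ints_of_int)
  qed
  have int_p: "of_nat (4 * k1) * (rat_of_nat p / 4) \<in> \<int>" for p
  proof -
    have "of_nat (4 * k1) * (rat_of_nat p / 4) = of_nat (k1 * p)" by simp
    then show ?thesis by (simp only: Ints_of_nat)
  qed
  let ?p = "of_nat (tuple_p (k1 + k2) (m N)) / 4 :: rat"
  let ?A = "A_form (k1 + k2) (\<lambda>a. of_nat (m N a) / 2 - of_nat (s a))"
  have "?A - c - ?p = limit_exponent k1 k2 i1 i2 j r"
    using A_form_x[OF facts] by (simp add: es c_def)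
  \<comment> \<open>Cross-multiplied so that each product has an exponent known to be integral in
    front.\<close>
  then have "qpow (4 * k1) (- c) * qpow (4 * k1) ?A
      = qpow (4 * k1) ?p * qpow (4 * k1) (limit_exponent k1 k2 i1 i2 j r)"
    unfolding qpow_add[OF int_c, symmetric] qpow_add[OF int_p, symmetric]
    by (simp add: algebra_simps)
  moreover have "qpow (4 * k1) ?p \<noteq> 0" by (simp add: qpow_def)
  ultimately have q: "qpow (4 * k1) (- c) * qpow (4 * k1) ?A / qpow (4 * k1) ?p
      = qpow (4 * k1) (limit_exponent k1 k2 i1 i2 j r)"
    by (simp add: field_simps)
  have "nat (int N + shift r) = t" using t by simp
  then have "finite_term N r = qpow (4 * k1) (limit_exponent k1 k2 i1 i2 j r)
      * (\<Prod>a=1..k1 + k2. qbinom (qvar (4 * k1))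
             (A_vec (k1 + k2) (\<lambda>b. of_nat (m N b) - 2 * of_nat (s b)) a
                - of_int (nu (k1 + k2) j a) + of_nat (s a)) (s a))"
    \<comment> \<open>\<open>A_vec_k1\<close> goes first: \<open>A_vec_idx\<close> holds at every
      index and would also rewrite the entry at \<open>k1\<close>.\<close>
    unfolding prod_idx finite_term_def prefactor_def A_vec_k1[OF facts]
    unfolding A_vec_idx[OF facts]
    by (simp add: s qs Cs mult_ac)
  then show ?thesis unfolding q[symmetric] by (simp add: c_def mult_ac)
qed

text \<open>Restriction to \<open>I\<close> forgets \<open>s_k1\<close> and \<open>e\<close>
  restores it. Integrality of the restored entry is the divisibility in \<open>S\<close>, its
  nonnegativity the condition in \<open>finite_tuples\<close>.\<close>

lemma restricted_Kostka_fusion: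
  assumes N: "N \<ge> 1"
  shows "qpow (4 * k1)
           (- ((of_nat i1 + of_nat i2 - of_nat j) * (of_nat i2 - of_nat i1 - of_nat j))
            / (4 * of_nat k1))
         * restricted_Kostka (4 * k1) (k1 + k2) j (m N) = (\<Sum>r\<in>finite_tuples N. finite_term N r)"
proof -
  define K where
    "K = {s \<in> {1..k1 + k2} \<rightarrow>\<^sub>E (UNIV :: nat set).
            2 * tuple_weight (k1 + k2) s + j = tuple_weight (k1 + k2) (m N)}"
  define e where "e r = r(k1 := nat (int N + shift r))" for r
  have weight_cong: "weight s = weight s'" if "\<And>\<beta>. \<beta> \<in> I \<Longrightarrow> s \<beta> = s' \<beta>" for s s'
    using that by (simp add: weight_def)
  have tuple_weight: "int (tuple_weight (k1 + k2) s) = int k1 * int (s k1) + weight s" for s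
    unfolding tuple_weight_def sum_idx by (simp add: weight_def)
  \<comment> \<open>The constraint becomes a linear equation for \<open>s_k1 - N\<close> whose
    right-hand side involves only entries in \<open>I\<close>.\<close>
  have K_iff: "s \<in> K \<longleftrightarrow> s \<in> {1..k1 + k2} \<rightarrow>\<^sub>E UNIV \<and>
      2 * int k1 * (int (s k1) - int N) = int i1 + int i2 - int j - 2 * weight s" for s
  proof -
    have "2 * tuple_weight (k1 + k2) s + j = tuple_weight (k1 + k2) (m N) \<longleftrightarrow>
        2 * int (tuple_weight (k1 + k2) s) + int j = int (i1 + i2 + 2 * N * k1)"
      unfolding tuple_weight_fusion[OF N] by linarith
    then show ?thesis by (auto simp: K_def tuple_weight algebra_simps)
  qed
  have restrict: "restrict s I \<in> S" "shift (restrict s I) = int (s k1) - int N" if "s \<in> K" for s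
  proof -
    have *: "int i1 + int i2 - int j - 2 * weight (restrict s I)
        = 2 * int k1 * (int (s k1) - int N)"
      using that weight_cong[of "restrict s I" s] by (simp add: K_iff)
    then show "restrict s I \<in> S"
      unfolding summation_tuples_def weight_def[symmetric] by simp
    show "shift (restrict s I) = int (s k1) - int N"
      unfolding shift_def * using k1 by simp
  qed
  have extend: "e r \<in> K" "restrict (e r) I = r" if "r \<in> finite_tuples N" for r
  proof -
    have r: "r \<in> S" "0 \<le> int N + shift r" using that by (auto simp: finite_tuples_def)
    then have "r \<in> I \<rightarrow>\<^sub>E UNIV" by (simp add: summation_tuples_def)
    then show "restrict (e r) I = r"
      using insert_idx(2) by (auto simp: e_def fun_eq_iff PiE_iff extensional_def)
    have "e r \<in> {1..k1 + k2} \<rightarrow>\<^sub>E UNIV"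
      using \<open>r \<in> I \<rightarrow>\<^sub>E UNIV\<close> unfolding insert_idx(1)
      by (auto simp: e_def PiE_iff extensional_def)
    moreover have "weight (e r) = weight r"
      using insert_idx(2) by (intro weight_cong) (auto simp: e_def)
    ultimately show "e r \<in> K" using r shift[OF r(1)] by (simp add: K_iff e_def)
  qed
  have e_restrict: "e (restrict s I) = s" if "s \<in> K" for s
  proof -
    have "s \<in> extensional (insert k1 I)"
      using that by (simp add: K_iff PiE_iff flip: insert_idx(1))
    then show ?thesis
      by (auto simp: e_def restrict(2)[OF that] extensional_def fun_eq_iff)
  qed
  show ?thesis
    unfolding restricted_Kostka_def K_def[symmetric] sum_divide_distrib sum_distrib_left
  proof (rule sum.reindex_bij_witness[where i = e and j = "\<lambda>s. restrict s I"])
    fix s assume s: "s \<in> K"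
    show "restrict s I \<in> finite_tuples N" using restrict[OF s] by (simp add: finite_tuples_def)
    show "e (restrict s I) = s" using e_restrict[OF s] .
    have eq: "int (s k1) = int N + shift (restrict s I)" using restrict[OF s] by simp
    show "finite_term N (restrict s I) = qpow (4 * k1)
           (- ((of_nat i1 + of_nat i2 - of_nat j) * (of_nat i2 - of_nat i1 - of_nat j))
            / (4 * of_nat k1))
         * (qpow (4 * k1) (A_form (k1 + k2) (\<lambda>a. of_nat (m N a) / 2 - of_nat (s a)))
        * (\<Prod>a=1..k1 + k2. qbinom (qvar (4 * k1))
             (A_vec (k1 + k2) (\<lambda>b. of_nat (m N b) - 2 * of_nat (s b)) a
                - of_int (nu (k1 + k2) j a) + of_nat (s a))
             (s a)) / qpow (4 * k1) (of_nat (tuple_p (k1 + k2) (m N)) / 4))"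
      using finite_term_eq[OF N restrict(1)[OF s] eq, of s] by simp
  qed (use extend in auto)
qed

section \<open>Passage to the limit\<close>

lemma finite_finite_tuples: "finite (finite_tuples N)"
proof -
  define b where "b = nat (int i1 + int i2 + 2 * int k1 * int N)"
  have "r \<alpha> \<le> b" if r: "r \<in> finite_tuples N" and \<alpha>: "\<alpha> \<in> I" for r \<alpha>
  proof -
    \<comment> \<open>Nonnegativity of \<open>s_k1\<close> bounds the weight linearly in
      \<open>N\<close>; as every index is at least 1, the weight bounds each entry.\<close>
    have "0 \<le> 2 * int k1 * (int N + shift r)"
      using r by (simp add: finite_tuples_def)
    then have "2 * weight r \<le> int i1 + int i2 + 2 * int k1 * int N"
      using shift[of r] r by (simp add: finite_tuples_def distrib_left)
    moreover have "int \<alpha> * int (r \<alpha>) \<le> weight r"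
      unfolding weight_def using \<alpha> by (intro member_le_sum) auto
    moreover have "int (r \<alpha>) \<le> int \<alpha> * int (r \<alpha>)"
      using \<alpha> by (simp add: idx_def mult_le_cancel_right1)
    ultimately show ?thesis unfolding b_def by linarith
  qed
  moreover have "r \<in> I \<rightarrow>\<^sub>E UNIV" if "r \<in> finite_tuples N" for r
    using that by (simp add: finite_tuples_def summation_tuples_def)
  ultimately have "finite_tuples N \<subseteq> I \<rightarrow>\<^sub>E {..b}"
    by (fastforce simp: PiE_iff)
  then show ?thesis by (rule finite_subset) (simp add: finite_PiE)
qed

lemma vanishes_below_prefactor:
  "vanishes_below (prefactor r) \<lfloor>of_nat (4 * k1) * limit_exponent k1 k2 i1 i2 j r\<rfloor>"
  unfolding prefactor_def using k1
  by (intro vanishes_below_mult_0 vanishes_below_qpow vanishes_below_prod vanishes_below_qbinom) auto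

text \<open>The difference is \<open>prefactor r\<close> times a binomial error of order at least
  \<open>t\<close>; orders add, and \<open>t\<close> grows with \<open>N\<close>.\<close>

lemma finite_term_tendsto:
  assumes "r \<in> S"
  shows "\<forall>\<^sub>F N in sequentially. r \<in> finite_tuples N
    \<and> vanishes_below (finite_term N r - limit_term (4 * k1) k1 k2 i1 i2 j r) n"
proof -
  define w where "w = \<lfloor>of_nat (4 * k1) * limit_exponent k1 k2 i1 i2 j r\<rfloor>"
  \<comment> \<open>The first summand ensures \<open>t \<ge> 0\<close>, the second
    \<open>n \<le> w + t\<close>.\<close>
  have "\<forall>\<^sub>F N in sequentially. nat (- shift r) + nat (n - w - shift r) \<le> N"
    by (rule eventually_ge_at_top)
  then show ?thesis
  proof eventually_elim
    case (elim N)
    define t where "t = nat (int N + shift r)"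
    have t: "0 \<le> int N + shift r" "n \<le> w + int t" using elim by (auto simp: t_def)
    have "finite_term N r - limit_term (4 * k1) k1 k2 i1 i2 j r = prefactor r *
        (qbinom (qvar (4 * k1)) (of_int (qindex r) + of_nat t) t
           - inv_qfact (qvar (4 * k1)) (qindex r))"
      by (simp add: finite_term_def limit_term_eq Let_def right_diff_distrib flip: t_def)
    moreover have "vanishes_below \<dots> (w + int t)"
      unfolding w_def using k1
      by (intro vanishes_below_mult vanishes_below_prefactor qbinom_tendsto_inv_qfact) auto
    ultimately show ?case
      using t assms vanishes_below_mono by (auto simp: finite_tuples_def)
  qed
qed

lemma Kostka_limit:
  "limit_term (4 * k1) k1 k2 i1 i2 j summable_on S"
  "(\<lambda>N. \<Sum>r\<in>finite_tuples N. finite_term N r)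
     \<longlonglongrightarrow> (\<Sum>\<^sub>\<infinity>r\<in>S. limit_term (4 * k1) k1 k2 i1 i2 j r)"
proof -
  define w where "w r = \<lfloor>of_nat (4 * k1) * limit_exponent k1 k2 i1 i2 j r\<rfloor>" for r
  have fin: "finite {r \<in> S. w r \<le> n}" for n
  proof (rule finite_subset)
    \<comment> \<open>A floor is at most \<open>n\<close> iff its argument is below
      \<open>n + 1\<close>.\<close>
    show "{r \<in> S. w r \<le> n}
        \<subseteq> {r \<in> I \<rightarrow>\<^sub>E UNIV. limit_exponent k1 k2 i1 i2 j r \<le> of_int (n + 1) / of_nat (4 * k1)}"
      using k1 by (auto simp: summation_tuples_def w_def floor_le_iff field_simps)
  qed (rule finite_limit_exponent_le[OF k1])
  have low: "vanishes_below (limit_term (4 * k1) k1 k2 i1 i2 j r) (w r)" for r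
    unfolding limit_term_eq w_def using k1
    by (intro vanishes_below_mult_0 vanishes_below_prefactor vanishes_below_inv_qfact) auto
  have low': "vanishes_below (finite_term N r) (w r)" for N r
    unfolding finite_term_def Let_def w_def using k1
    by (intro vanishes_below_mult_0 vanishes_below_prefactor vanishes_below_qbinom) auto
  have sub: "finite_tuples N \<subseteq> S" for N by (auto simp: finite_tuples_def)
  note lim = fls_dominated_convergence[OF fin low low' finite_term_tendsto
      finite_finite_tuples sub]
  show "limit_term (4 * k1) k1 k2 i1 i2 j summable_on S" by (rule lim(1))
  show "(\<lambda>N. \<Sum>r\<in>finite_tuples N. finite_term N r)
     \<longlonglongrightarrow> (\<Sum>\<^sub>\<infinity>r\<in>S. limit_term (4 * k1) k1 k2 i1 i2 j r)" by (rule lim(2))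
qed

end

text \<open>Summability is asserted as well, because an infinite sum that does not exist has the
  default value 0.\<close>

theorem theorem4p1:
  fixes k1 k2 i1 i2 j :: nat
  assumes "k1 \<ge> 1" and "k2 \<ge> 1" and "i1 \<le> k1" and "i2 \<le> k2" and "j \<le> k1 + k2"
  shows "limit_term (4 * k1) k1 k2 i1 i2 j summable_on summation_tuples k1 k2 i1 i2 j \<and>
    (\<lambda>N. qpow (4 * k1)
           (- ((of_nat i1 + of_nat i2 - of_nat j) * (of_nat i2 - of_nat i1 - of_nat j))
            / (4 * of_nat k1))
         * restricted_Kostka (4 * k1) (k1 + k2) j (fusion_tuple k1 i1 i2 N))
    \<longlonglongrightarrow> (\<Sum>\<^sub>\<infinity>s\<in>summation_tuples k1 k2 i1 i2 j. limit_term (4 * k1) k1 k2 i1 i2 j s)"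
proof -
  interpret fusion_data k1 k2 i1 i2 j using assms by unfold_locales
  have "\<forall>\<^sub>F N in sequentially. (\<Sum>r\<in>finite_tuples N. finite_term N r) = qpow (4 * k1)
           (- ((of_nat i1 + of_nat i2 - of_nat j) * (of_nat i2 - of_nat i1 - of_nat j))
            / (4 * of_nat k1))
         * restricted_Kostka (4 * k1) (k1 + k2) j (fusion_tuple k1 i1 i2 N)"
    \<comment> \<open>At \<open>N = 0\<close> the truncated \<open>2 * N - 1\<close> is 0, so the
      identity is used from \<open>N = 1\<close> on, which is enough for the limit.\<close>
    using eventually_ge_at_top[of 1] by eventually_elim (simp only: restricted_Kostka_fusion)
  with Kostka_limit show ?thesis by (blast intro: Lim_transform_eventually)
qed

end
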